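(* Let $q$ be a prime power and let $\ell$ be an integer with $2<\ell\le q$. The set of all distinct Reed--Solomon codes of dimension $2$ and length $\ell$ over $\mathbb{F}_q$ is an $(\ell,2,q;1)$ Reed--Solomon sunflower with center $\langle\underline{1}\rangle_{\mathbb{F}_q}$ and size $$\frac{(q-2)!}{(q-\ell)!}=\Omega_\ell(q^{\ell-2}).$$
   Context: $\underline{1}=(1,\ldots,1)$. For $\underline{\alpha}=(\alpha_1,\ldots,\alpha_\ell)\in\mathbb{F}_q^\ell$ with pairwise distinct entries, the Reed--Solomon (RS) code is $\mathsf{RS}_{\ell,k}(\underline{\alpha})=\{(f(\alpha_1),\ldots,f(\alpha_\ell)) : f\in\mathbb{F}_q[x],\ \deg f<k\}$, a $k$-dimensional subspace of $\mathbb{F}_q^\ell$. For $1\le c<k\le\ell\le q$, a family of $k$-dimensional RS codes in $\mathbb{F}_q^\ell$ is an $(\ell,k,q;c)$ Reed--Solomon sunflower if there is a fixed $c$-dimensional subspace $E\subseteq\mathbb{F}_q^\ell$ (the center) such that any two distinct codes of the family intersect exactly in $E$. $\Omega_\ell(\cdot)$ means a lower bound up to a positive multiplicative constant depending only on $\ell$. *)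

theory Defs
  imports "HOL-Analysis.Cartesian_Space" "HOL-Computational_Algebra.Polynomial"
    "HOL-Number_Theory.Prime_Powers"
begin

text \<open>
  The space \<open>F_q^l\<close> is rendered as \<open>'a ^ 'n\<close> with \<open>'a\<close> a finite field, \<open>q = CARD('a)\<close> and
  \<open>l = CARD('n)\<close>; its linear algebra is the library interpretation \<open>vec\<close> (scalars \<open>(*s)\<close>).
\<close>

text \<open>The disjunct \<open>f = 0\<close> implements the convention \<open>deg 0 = -\<infinity>\<close> (\<open>degree 0 = 0\<close> in the library).\<close>

definition RS_code :: "nat \<Rightarrow> 'a::field ^ 'n \<Rightarrow> ('a ^ 'n) set" where
  "RS_code k \<alpha> = {(\<chi> i. poly f (\<alpha> $ i)) | f. f = 0 \<or> degree f < k}"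

text \<open>
  Distinct evaluation vectors may define the same code; \<open>RS_codes k\<close> is the set of
  codes, so each code occurs in it once.
\<close>

definition RS_codes :: "nat \<Rightarrow> ('a::field ^ 'n) set set" where
  "RS_codes k = {RS_code k \<alpha> | \<alpha>. inj (($) \<alpha>)}"

definition RS_sunflower ::
  "nat \<Rightarrow> nat \<Rightarrow> nat \<Rightarrow> nat \<Rightarrow> ('a::{field,finite} ^ 'n) set set \<Rightarrow> ('a ^ 'n) set \<Rightarrow> bool" where
  "RS_sunflower l k q c \<F> E \<longleftrightarrow>
     CARD('n) = l \<and> CARD('a) = q \<and> 1 \<le> c \<and> c < k \<and> k \<le> l \<and> l \<le> q \<and>
     (\<forall>C\<in>\<F>. C \<in> RS_codes k \<and> vec.subspace C \<and> vec.dim C = k) \<and>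
     vec.subspace E \<and> vec.dim E = c \<and>
     (\<forall>C\<in>\<F>. \<forall>D\<in>\<F>. C \<noteq> D \<longrightarrow> C \<inter> D = E)"

end

theory Submission
  imports Defs
begin

text \<open>
  The two-dimensional Reed--Solomon code of \<open>\<alpha>\<close> consists of the vectors \<open>x \<one> + y \<alpha>\<close>, the images
  of \<open>\<alpha>\<close> under the affine maps of the field. Affine maps with \<open>y \<noteq> 0\<close> are invertible, so every
  non-constant codeword is itself an evaluation vector of the same code
  (\<open>RS_code_2_eqI_codeword\<close>). Hence two codes that share a non-constant word coincide, whereas all
  of them contain the constant words: distinct codes meet exactly in the line spanned by \<open>\<one>\<close>.

  For the size, fix two coordinates \<open>i \<noteq> j\<close>. As the affine group acts sharply 2-transitively on the
  field, each code has exactly one codeword with entry \<open>0\<close> at \<open>i\<close> and \<open>1\<close> at \<open>j\<close>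
  (\<open>card_RS_codes_2_eq_card_injections\<close>). The codes are thus in bijection with the injections of the
  remaining \<open>l - 2\<close> coordinates into the \<open>q - 2\<close> field elements other than \<open>0\<close> and \<open>1\<close>; these
  number \<open>(q - 2) (q - 3) \<cdots> (q - l + 1)\<close>. Each of the \<open>l - 2\<close> factors is at least \<open>q / l\<close>, which
  gives the asymptotic bound with the constant \<open>(1 / l) ^ (l - 2)\<close>.
\<close>

section \<open>Codewords of two-dimensional Reed--Solomon codes\<close>

lemma mem_RS_code_2_iff:
  "v \<in> RS_code 2 \<alpha> \<longleftrightarrow> (\<exists>x y. v = (\<chi> i. x + y * \<alpha> $ i))"
proof
  assume "v \<in> RS_code 2 \<alpha>"
  then obtain f where v: "v = (\<chi> i. poly f (\<alpha> $ i))" and f: "f = 0 \<or> degree f < 2"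
    unfolding RS_code_def by blast
  have "degree f \<le> 1"
    using f by auto
  obtain x g where f_eq: "f = pCons x g"
    by (rule pCons_cases)
  with \<open>degree f \<le> 1\<close> have "degree g = 0"
    by (auto split: if_splits)
  then obtain y where "f = [:x, y:]"
    using f_eq by (auto elim: degree_eq_zeroE)
  then show "\<exists>x y. v = (\<chi> i. x + y * \<alpha> $ i)"
    using v by (auto simp: mult.commute)
next
  assume "\<exists>x y. v = (\<chi> i. x + y * \<alpha> $ i)"
  then obtain x y where "v = (\<chi> i. x + y * \<alpha> $ i)"
    by blast
  then have "v = (\<chi> i. poly [:x, y:] (\<alpha> $ i))"
    by (simp add: mult.commute)
  moreover have "degree [:x, y:] < 2"
    by simp
  ultimately show "v \<in> RS_code 2 \<alpha>"
    unfolding RS_code_def by blast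
qed

lemma mem_span_ones_iff:
  "v \<in> vec.span {\<chi> i. 1} \<longleftrightarrow> (\<exists>x. v = (\<chi> i. x))"
  by (auto simp: vec.span_singleton vec_eq_iff)

lemma RS_code_2_eq_span: "RS_code 2 \<alpha> = vec.span {\<alpha>, \<chi> i. 1}"
proof (rule set_eqI)
  fix v
  have "v - y *s \<alpha> = (\<chi> i. x) \<longleftrightarrow> v = (\<chi> i. x + y * \<alpha> $ i)" for x y
    by (auto simp: vec_eq_iff diff_eq_eq)
  then show "v \<in> RS_code 2 \<alpha> \<longleftrightarrow> v \<in> vec.span {\<alpha>, \<chi> i. 1}"
    unfolding mem_RS_code_2_iff vec.span_breakdown_eq[of v \<alpha>] mem_span_ones_iff by blast
qed

lemma span_ones_subset_RS_code_2: "vec.span {\<chi> i. 1} \<subseteq> RS_code 2 \<alpha>"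
  unfolding RS_code_2_eq_span by (rule vec.span_mono) blast

lemma dim_span_ones:
  "vec.dim (vec.span {(\<chi> i. 1) :: 'a::field ^ 'n::finite}) = 1"
proof -
  have "vec.independent {(\<chi> i. 1) :: 'a ^ 'n}"
    by (simp add: vec_eq_iff)
  then show ?thesis
    by (subst vec.dim_span_eq_card_independent) simp_all
qed

lemma dim_RS_code_2:
  fixes \<alpha> :: "'a::field ^ 'n::finite"
  assumes "\<alpha> $ i \<noteq> \<alpha> $ j"
  shows "vec.dim (RS_code 2 \<alpha>) = 2"
proof -
  have nonconst: "\<alpha> \<notin> vec.span {\<chi> i. 1}"
    using assms by (auto simp: mem_span_ones_iff)
  moreover have "vec.independent {(\<chi> i. 1) :: 'a ^ 'n}"
    by (simp add: vec_eq_iff)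
  ultimately have "vec.independent {\<alpha>, \<chi> i. 1}"
    by (rule vec.independent_insertI)
  moreover have "\<alpha> \<noteq> (\<chi> i. 1)"
    using assms by auto
  ultimately show ?thesis
    unfolding RS_code_2_eq_span by (subst vec.dim_span_eq_card_independent) simp_all
qed

text \<open>The affine map \<open>t \<mapsto> x + y t\<close> carrying \<open>\<alpha>\<close> to the codeword \<open>v\<close> has slope \<open>y \<noteq> 0\<close> because
  \<open>v\<close> is not constant; its inverse recovers \<open>\<alpha>\<close> from \<open>v\<close>, so \<open>v\<close> generates the whole code.\<close>

lemma RS_code_2_eqI_codeword:
  assumes "v \<in> RS_code 2 \<alpha>" and "v \<notin> vec.span {\<chi> i. 1}"
  shows "RS_code 2 v = RS_code 2 \<alpha>"
proof
  obtain x y where v: "v = (\<chi> i. x + y * \<alpha> $ i)"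
    using assms(1) by (auto simp: mem_RS_code_2_iff)
  have "y \<noteq> 0"
    using assms(2) by (auto simp: v mem_span_ones_iff)
  then have "\<alpha> = (\<chi> i. - x / y + 1 / y * v $ i)"
    by (simp add: v vec_eq_iff field_simps)
  then have "\<alpha> \<in> RS_code 2 v"
    unfolding mem_RS_code_2_iff by blast
  then show "RS_code 2 \<alpha> \<subseteq> RS_code 2 v"
    using span_ones_subset_RS_code_2[of v]
    unfolding RS_code_2_eq_span by (intro vec.span_minimal) (auto intro: vec.span_base)
  show "RS_code 2 v \<subseteq> RS_code 2 \<alpha>"
    using assms(1) span_ones_subset_RS_code_2[of \<alpha>]
    unfolding RS_code_2_eq_span by (intro vec.span_minimal) (auto intro: vec.span_base)
qed

lemma RS_code_2_Int:
  assumes "RS_code 2 \<alpha> \<noteq> RS_code 2 \<beta>"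
  shows "RS_code 2 \<alpha> \<inter> RS_code 2 \<beta> = vec.span {\<chi> i. 1}"
proof
  show "RS_code 2 \<alpha> \<inter> RS_code 2 \<beta> \<subseteq> vec.span {\<chi> i. 1}"
  proof (rule subsetI, rule ccontr)
    fix v
    assume "v \<in> RS_code 2 \<alpha> \<inter> RS_code 2 \<beta>" and "v \<notin> vec.span {\<chi> i. 1}"
    then have "RS_code 2 v = RS_code 2 \<alpha>" and "RS_code 2 v = RS_code 2 \<beta>"
      by (auto intro!: RS_code_2_eqI_codeword)
    with assms show False
      by simp
  qed
qed (simp add: span_ones_subset_RS_code_2)

section \<open>Counting the codes\<close>

text \<open>An injection \<open>f\<close> on the coordinates other than \<open>i\<close> and \<open>j\<close> is completed to an evaluation vector
  by the values \<open>0\<close> at \<open>i\<close> and \<open>1\<close> at \<open>j\<close>. An affine map fixing \<open>0\<close> and \<open>1\<close> is the identity, so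
  different injections give different codes; and the affine map that sends two given distinct field
  elements to \<open>0\<close> and \<open>1\<close> brings any evaluation vector into this form without changing its code.\<close>

lemma card_RS_codes_2_eq_card_injections:
  fixes i j :: "'n::finite"
  assumes "i \<noteq> j"
  shows "card (RS_codes 2 :: ('a::field ^ 'n) set set)
    = card {f \<in> (- {i, j}) \<rightarrow>\<^sub>E (- {0, 1 :: 'a}). inj_on f (- {i, j})}"
proof -
  let ?F = "{f \<in> (- {i, j}) \<rightarrow>\<^sub>E (- {0, 1 :: 'a}). inj_on f (- {i, j})}"
  define ext :: "('n \<Rightarrow> 'a) \<Rightarrow> 'a ^ 'n"
    where "ext f = (\<chi> k. if k = i then 0 else if k = j then 1 else f k)" for f
  have "bij_betw (\<lambda>f. RS_code 2 (ext f)) ?F (RS_codes 2)"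
  proof (rule bij_betw_imageI)
    show "inj_on (\<lambda>f. RS_code 2 (ext f)) ?F"
    proof (rule inj_onI)
      fix f g
      assume f: "f \<in> ?F" and g: "g \<in> ?F" and eq: "RS_code 2 (ext f) = RS_code 2 (ext g)"
      have "ext f \<in> RS_code 2 (ext f)"
        by (auto simp: RS_code_2_eq_span intro: vec.span_base)
      then obtain x y where xy: "ext f = (\<chi> k. x + y * ext g $ k)"
        unfolding eq mem_RS_code_2_iff by blast
      have "x = 0"
        using arg_cong[OF xy, of "\<lambda>v. v $ i"] by (simp add: ext_def)
      moreover have "x + y = 1"
        using arg_cong[OF xy, of "\<lambda>v. v $ j"] assms by (simp add: ext_def)
      ultimately have "ext f = ext g"
        using xy by simp
      then have "f k = g k" if "k \<in> - {i, j}" for k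
        using that by (auto simp: ext_def vec_eq_iff split: if_splits)
      then show "f = g"
        using f g by (intro PiE_ext[of f "- {i, j}" "\<lambda>_. - {0, 1}"]) auto
    qed
    show "(\<lambda>f. RS_code 2 (ext f)) ` ?F = RS_codes 2"
    proof
      have "inj (($) (ext f))" if "f \<in> ?F" for f
      proof (rule injI)
        fix k m
        assume eq: "ext f $ k = ext f $ m"
        have val: "f k \<noteq> 0 \<and> f k \<noteq> 1" if "k \<noteq> i" "k \<noteq> j" for k
          using PiE_mem[of f "- {i, j}" "\<lambda>_. - {0, 1}" k] that \<open>f \<in> ?F\<close> by auto
        have "inj_on f (- {i, j})"
          using that by simp
        then show "k = m"
          using eq val[of k] val[of m] inj_onD[of f "- {i, j}" k m]
          by (auto simp: ext_def split: if_splits)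
      qed
      then show "(\<lambda>f. RS_code 2 (ext f)) ` ?F \<subseteq> RS_codes 2"
        unfolding RS_codes_def by blast
      show "RS_codes 2 \<subseteq> (\<lambda>f. RS_code 2 (ext f)) ` ?F"
      proof
        fix C :: "('a ^ 'n) set"
        assume "C \<in> RS_codes 2"
        then obtain \<alpha> where C: "C = RS_code 2 \<alpha>" and inj: "inj (($) \<alpha>)"
          unfolding RS_codes_def by blast
        have inj_iff: "\<alpha> $ k = \<alpha> $ m \<longleftrightarrow> k = m" for k m
          using inj by (simp add: inj_eq)
        define v where "v k = (\<alpha> $ k - \<alpha> $ i) / (\<alpha> $ j - \<alpha> $ i)" for k
        have nz: "\<alpha> $ j - \<alpha> $ i \<noteq> 0"
          using assms by (simp add: inj_iff)
        have v_eq_iff: "v k = v m \<longleftrightarrow> k = m" for k m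
          using nz by (simp add: v_def inj_iff)
        have vi: "v i = 0" and vj: "v j = 1"
          using nz by (simp_all add: v_def)
        let ?f = "restrict v (- {i, j})"
        have "v k \<noteq> 0 \<and> v k \<noteq> 1" if "k \<in> - {i, j}" for k
          using v_eq_iff[of k i] v_eq_iff[of k j] that by (simp add: vi vj)
        then have "?f \<in> ?F"
          by (auto simp: inj_on_def v_eq_iff)
        moreover have "RS_code 2 (ext ?f) = C"
        proof -
          have ext: "ext ?f = (\<chi> k. v k)"
            by (simp add: ext_def vec_eq_iff vi vj)
          also have "\<dots> = (\<chi> k. - (\<alpha> $ i) / (\<alpha> $ j - \<alpha> $ i) + 1 / (\<alpha> $ j - \<alpha> $ i) * \<alpha> $ k)"
            by (simp add: v_def vec_eq_iff diff_divide_distrib)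
          finally have "ext ?f \<in> RS_code 2 \<alpha>"
            unfolding mem_RS_code_2_iff by blast
          moreover have "ext ?f \<notin> vec.span {\<chi> i. 1}"
          proof
            assume "ext ?f \<in> vec.span {\<chi> i. 1}"
            then obtain x where "ext ?f = (\<chi> k. x)"
              by (auto simp: mem_span_ones_iff)
            then have "v i = x" and "v j = x"
              unfolding ext by (auto simp: vec_eq_iff)
            then show False
              by (simp add: vi vj)
          qed
          ultimately show ?thesis
            unfolding C by (rule RS_code_2_eqI_codeword)
        qed
        ultimately show "C \<in> (\<lambda>f. RS_code 2 (ext f)) ` ?F"
          by blast
      qed
    qed
  qed
  then show ?thesis
    by (simp add: bij_betw_same_card)
qed

lemma falling_factorial_eq_fact_div:
  fixes N k :: nat
  assumes "k \<le> N"
  shows "real (\<Prod>m = 0..<k. N - m) = fact N / fact (N - k)"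
  using assms
proof (induction k)
  case 0
  then show ?case by simp
next
  case (Suc k)
  have fact_step: "fact (N - k) = real (N - k) * fact (N - Suc k)"
    using Suc.prems fact_reduce[of "N - k", where 'a = real] by simp
  have "real (\<Prod>m = 0..<Suc k. N - m) = real (\<Prod>m = 0..<k. N - m) * real (N - k)"
    by (simp only: prod.atLeast0_lessThan_Suc of_nat_mult)
  also have "\<dots> = fact N / fact (N - k) * real (N - k)"
    using Suc by simp
  also have "\<dots> = fact N / fact (N - Suc k)"
    unfolding fact_step using Suc.prems by simp
  finally show ?case .
qed

text \<open>The factor \<open>Q - 2 - m\<close> is at least \<open>Q - l + 1\<close>, and \<open>Q \<le> l (Q - l + 1)\<close> is equivalent to
  \<open>0 \<le> (Q - l) (l - 1)\<close>.\<close>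

lemma power_le_falling_factorial:
  fixes l Q :: nat
  assumes "2 \<le> l" and "l \<le> Q"
  shows "(1 / real l) ^ (l - 2) * real Q ^ (l - 2) \<le> fact (Q - 2) / fact (Q - l)"
proof -
  have factor: "real Q / real l \<le> real (Q - 2 - m)" if "m < l - 2" for m
  proof -
    have "0 \<le> (real Q - real l) * (real l - 1)"
      using assms by simp
    then have "real Q \<le> (real Q - real l + 1) * real l"
      by (simp add: algebra_simps)
    then have "real Q / real l \<le> real Q - real l + 1"
      using assms by (simp add: pos_divide_le_eq)
    also have "\<dots> \<le> real (Q - 2 - m)"
      using that assms by linarith
    finally show ?thesis .
  qed
  have "(1 / real l) ^ (l - 2) * real Q ^ (l - 2) = (\<Prod>m = 0..<l - 2. real Q / real l)"
    by (simp add: power_mult_distrib[symmetric])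
  also have "\<dots> \<le> (\<Prod>m = 0..<l - 2. real (Q - 2 - m))"
    using factor by (intro prod_mono) auto
  also have "\<dots> = real (\<Prod>m = 0..<l - 2. Q - 2 - m)"
    by simp
  also have "\<dots> = fact (Q - 2) / fact (Q - 2 - (l - 2))"
    using assms by (intro falling_factorial_eq_fact_div) simp
  also have "Q - 2 - (l - 2) = Q - l"
    using assms by simp
  finally show ?thesis .
qed

lemma obtain_distinct:
  assumes "2 \<le> CARD('n::finite)"
  obtains i j :: "'n::finite" where "i \<noteq> j"
proof -
  have "\<not> card (UNIV :: 'n set) \<le> Suc 0"
    using assms by simp
  then show ?thesis
    using that by (auto simp: card_le_Suc0_iff_eq)
qed

lemma card_RS_codes_2:
  assumes "2 \<le> CARD('n::finite)" and "CARD('n) \<le> CARD('a::{field,finite})"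
  shows "real (card (RS_codes 2 :: ('a ^ 'n) set set))
    = fact (CARD('a) - 2) / fact (CARD('a) - CARD('n))"
proof -
  obtain i j :: 'n where ij: "i \<noteq> j"
    using assms(1) by (rule obtain_distinct)
  have S: "card (- {i, j}) = CARD('n) - 2"
    using ij by (simp add: Compl_eq_Diff_UNIV card_Diff_subset)
  have T: "card (- {0, 1 :: 'a}) = CARD('a) - 2"
    by (simp add: Compl_eq_Diff_UNIV card_Diff_subset)
  have "card (RS_codes 2 :: ('a ^ 'n) set set)
    = (\<Prod>m = 0..<CARD('n) - 2. CARD('a) - 2 - m)"
    unfolding card_RS_codes_2_eq_card_injections[OF ij]
    by (subst card_inj_on_subset_funcset) (simp_all add: S T)
  then have "real (card (RS_codes 2 :: ('a ^ 'n) set set))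
    = fact (CARD('a) - 2) / fact (CARD('a) - 2 - (CARD('n) - 2))"
    using assms by (simp only: falling_factorial_eq_fact_div)
  also have "CARD('a) - 2 - (CARD('n) - 2) = CARD('a) - CARD('n)"
    using assms by simp
  finally show ?thesis .
qed

section \<open>The sunflower of all two-dimensional codes\<close>

lemma RS_sunflower_RS_codes_2:
  assumes "2 \<le> CARD('n::finite)" and "CARD('n) \<le> CARD('a::{field,finite})"
  shows "RS_sunflower CARD('n) 2 CARD('a) 1 (RS_codes 2 :: ('a ^ 'n) set set)
    (vec.span {\<chi> i. 1})"
proof -
  obtain i j :: 'n where ij: "i \<noteq> j"
    using assms(1) by (rule obtain_distinct)
  have "vec.subspace C \<and> vec.dim C = 2" if C_mem: "C \<in> RS_codes 2" for C :: "('a ^ 'n) set"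
  proof -
    obtain \<alpha> where C: "C = RS_code 2 \<alpha>" and "inj (($) \<alpha>)"
      using C_mem unfolding RS_codes_def by blast
    then have "\<alpha> $ i \<noteq> \<alpha> $ j"
      using ij by (simp add: inj_eq)
    then have "vec.dim C = 2"
      unfolding C by (rule dim_RS_code_2)
    then show ?thesis
      by (simp add: C RS_code_2_eq_span)
  qed
  moreover have "C \<inter> D = vec.span {\<chi> i. 1}"
    if "C \<in> RS_codes 2" "D \<in> RS_codes 2" "C \<noteq> D" for C D :: "('a ^ 'n) set"
    using that RS_code_2_Int unfolding RS_codes_def by blast
  ultimately show ?thesis
    using assms unfolding RS_sunflower_def by (simp add: dim_span_ones del: vec.dim_span)
qed

theorem corollary3p4:
  fixes q l :: nat
  assumes "primepow q" and "CARD('a::{field,finite}) = q" and "CARD('n::finite) = l"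
    and "2 < l" and "l \<le> q"
  shows "RS_sunflower l 2 q 1 (RS_codes 2 :: ('a ^ 'n) set set) (vec.span {\<chi> i. 1})
    \<and> real (card (RS_codes 2 :: ('a ^ 'n) set set)) = fact (q - 2) / fact (q - l)
    \<and> (\<exists>K::real. K > 0 \<and>
          (\<forall>Q::nat. primepow Q \<and> l \<le> Q \<longrightarrow>
             fact (Q - 2) / fact (Q - l) \<ge> K * real Q ^ (l - 2)))"
proof (intro conjI)
  show "RS_sunflower l 2 q 1 (RS_codes 2 :: ('a ^ 'n) set set) (vec.span {\<chi> i. 1})"
    using RS_sunflower_RS_codes_2[where 'a = 'a and 'n = 'n] assms by simp
  show "real (card (RS_codes 2 :: ('a ^ 'n) set set)) = fact (q - 2) / fact (q - l)"
    using card_RS_codes_2[where 'a = 'a and 'n = 'n] assms by simp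
  have "(1 / real l) ^ (l - 2) > 0"
    using assms by simp
  then show "\<exists>K::real. K > 0 \<and>
      (\<forall>Q::nat. primepow Q \<and> l \<le> Q \<longrightarrow>
         fact (Q - 2) / fact (Q - l) \<ge> K * real Q ^ (l - 2))"
    using power_le_falling_factorial assms(4)
    by (intro exI[of _ "(1 / real l) ^ (l - 2)"]) simp
qed

end
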